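(* Let $\mathbb{O}$ be the $\mathbb{R}$-algebra with $\mathbb{R}$-basis $\lbrace e^x : x \in \mathbb{F}_8 \rbrace$ and $\mathbb{R}$-bilinear multiplication determined by $$e^x e^y = (-1)^{\varphi(x,y)} e^{x+y}, \qquad \varphi(x,y) = \mathrm{tr}(y x^6) \in \mathbb{F}_2, \qquad x, y \in \mathbb{F}_8 .$$ Then $\mathbb{O}$ is (isomorphic as an $\mathbb{R}$-algebra to) the real non-associative division algebra of octonions.
   Context: $\mathbb{F}_q$ denotes the field with $q$ elements. The map $\mathrm{tr}:\mathbb{F}_8 \to \mathbb{F}_2$ is $\mathrm{tr}(x) = x + x^2 + x^4$. For $x \in \mathbb{F}_8$, $x^6 = x^{-1}$ if $x \neq 0$ and $x^6 = 0$ if $x = 0$. For $\epsilon \in \mathbb{F}_2$, $(-1)^\epsilon$ is $1$ if $\epsilon = 0$ and $-1$ if $\epsilon = 1$. The octonions are the standard 8-dimensional real algebra: it has a basis consisting of a two-sided identity $1 = e_\infty$ and elements $e_i$ ($i \in \mathbb{Z}/7\mathbb{Z}$) with $e_i^2 = -1$, $e_i e_j = -e_j e_i$ for $i \neq j$, and, for every $i\in \mathbb{Z}/7\mathbb{Z}$, $e_i e_{i+1} = e_{i+3}$, $e_{i+1}e_{i+3} = e_i$, $e_{i+3}e_i = e_{i+1}$. *)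

theory Defs
  imports "HOL-Analysis.Analysis" "HOL-Library.Numeral_Type"
begin

section \<open>Real algebras\<close>

text \<open>
  A real algebra (not assumed associative or unital) is a real vector space together with a
  bilinear product, which is passed around explicitly. The bilinear extension of a table
  \<open>p\<close> of products of basis vectors is given on the free vector space
  \<^typ>\<open>real ^ 'i\<close>, whose standard basis is \<open>axis i 1\<close>.
\<close>

definition bilinear_extension ::
    "('i \<Rightarrow> 'i \<Rightarrow> real ^ 'i) \<Rightarrow> real ^ 'i \<Rightarrow> real ^ 'i \<Rightarrow> real ^ 'i::finite" where
  "bilinear_extension p a b = (\<Sum>i\<in>UNIV. \<Sum>j\<in>UNIV. (a $ i * b $ j) *\<^sub>R p i j)"

definition algebra_isomorphic ::
    "('a::real_vector \<Rightarrow> 'a \<Rightarrow> 'a) \<Rightarrow> ('b::real_vector \<Rightarrow> 'b \<Rightarrow> 'b) \<Rightarrow> bool" where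
  "algebra_isomorphic m n \<longleftrightarrow>
     (\<exists>f. linear f \<and> bij f \<and> (\<forall>a b. f (m a b) = n (f a) (f b)))"

definition associative_product :: "('a \<Rightarrow> 'a \<Rightarrow> 'a) \<Rightarrow> bool" where
  "associative_product m \<longleftrightarrow> (\<forall>a b c. m (m a b) c = m a (m b c))"

definition division_algebra :: "('a::real_vector \<Rightarrow> 'a \<Rightarrow> 'a) \<Rightarrow> bool" where
  "division_algebra m \<longleftrightarrow>
     bilinear m \<and> (\<exists>a::'a. a \<noteq> 0) \<and>
     (\<forall>a b. a \<noteq> 0 \<longrightarrow> (\<exists>!x. m a x = b) \<and> (\<exists>!y. m y a = b))"

lemma bilinear_bilinear_extension: "bilinear (bilinear_extension p)"
  unfolding bilinear_def bilinear_extension_def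
  by (auto intro!: linearI
      simp: algebra_simps sum.distrib scaleR_sum_right)

lemma bilinear_extension_axis:
  "bilinear_extension p (axis i 1) (axis j 1) = p i j"
proof -
  have "bilinear_extension p (axis i 1) (axis j 1) =
      (\<Sum>k\<in>UNIV. \<Sum>l\<in>UNIV. if l = j then (if k = i then p k l else 0) else 0)"
    unfolding bilinear_extension_def by (intro sum.cong refl) (auto simp: axis_def)
  also have "\<dots> = p i j"
    by simp
  finally show ?thesis .
qed


section \<open>The twisted group algebra of the additive group of the field with eight elements\<close>

text \<open>
  The field with eight elements is any finite field type \<open>'f\<close> with \<open>CARD('f) = 8\<close>.
  The trace takes values in the prime field, which is the subset \<open>{0, 1}\<close> of \<open>'f\<close>.
\<close>

definition tr :: "'f::{field, finite} \<Rightarrow> 'f" where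
  "tr x = x + x ^ 2 + x ^ 4"

definition phi :: "'f::{field, finite} \<Rightarrow> 'f \<Rightarrow> 'f" where
  "phi x y = tr (y * x ^ 6)"

text \<open>\<open>sign_pow \<epsilon>\<close> is \<open>(-1)\<^sup>\<epsilon>\<close>; it is only meaningful for \<open>\<epsilon> \<in> {0, 1}\<close>.\<close>

definition sign_pow :: "'f::{field, finite} \<Rightarrow> real" where
  "sign_pow \<epsilon> = (if \<epsilon> = 0 then 1 else -1)"

definition twisted_mult ::
    "(real, 'f::{field, finite}) vec \<Rightarrow> (real, 'f) vec \<Rightarrow> (real, 'f) vec" where
  "twisted_mult = bilinear_extension (\<lambda>x y. sign_pow (phi x y) *\<^sub>R axis (x + y) 1)"

lemma twisted_mult_axis:
  "twisted_mult (axis x 1) (axis y 1) = sign_pow (phi x y) *\<^sub>R axis (x + y) 1"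
  by (simp add: twisted_mult_def bilinear_extension_axis)

lemma tr_in_prime_field:
  fixes x :: "'f::{field, finite}"
  assumes "CARD('f) = 8"
  shows "tr x \<in> {0, 1}"
proof -
  have x8: "y ^ 8 = y" for y :: 'f
  proof (cases "y = 0")
    case False
    have "bij_betw (\<lambda>z. y * z) (UNIV - {0}) (UNIV - {0})"
      using False by (intro bij_betwI[where g = "\<lambda>z. z / y"]) auto
    then have "(\<Prod>z\<in>UNIV - {0}. y * z) = (\<Prod>z\<in>UNIV - {0}. z)"
      by (rule prod.reindex_bij_betw)
    then have "y ^ 7 * \<Prod>(UNIV - {0 :: 'f}) = \<Prod>(UNIV - {0})"
      using assms by (simp add: prod.distrib card_Diff_singleton)
    then have "y ^ 7 = 1" by simp
    then show ?thesis by (simp add: power_Suc[of y 7, simplified])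
  qed simp
  have "(-1 :: 'f) = 1"
    using x8[of "-1"] by simp
  then have "1 + 1 = (0 :: 'f)"
    by (metis add.right_inverse)
  then have two: "a + a = 0" for a :: 'f
    by (metis distrib_left mult.right_neutral mult_zero_right)
  have sq: "(a + b) ^ 2 = a ^ 2 + b ^ 2" for a b :: 'f
    using two[of "a * b"] by (simp add: power2_eq_square algebra_simps)
  have "tr x ^ 2 = x ^ 2 + x ^ 4 + x ^ 8"
    by (simp add: tr_def sq flip: power_mult)
  then have "tr x ^ 2 = tr x"
    using x8[of x] by (simp add: tr_def)
  then show ?thesis
    by (auto simp: power2_eq_square)
qed


section \<open>The octonions\<close>

text \<open>
  The index type is \<^typ>\<open>7 option\<close>: \<^term>\<open>None\<close> is the index \<open>\<infinity>\<close> of the identity, and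
  \<^term>\<open>Some i\<close> is \<open>i \<in> \<int>/7\<int>\<close>, where \<^typ>\<open>7\<close> is the numeral type with arithmetic
  modulo \<open>7\<close>. For \<open>i \<noteq> j\<close>, the rules \<open>e\<^sub>i e\<^sub>i\<^sub>+\<^sub>1 = e\<^sub>i\<^sub>+\<^sub>3\<close>,
  \<open>e\<^sub>i\<^sub>+\<^sub>1 e\<^sub>i\<^sub>+\<^sub>3 = e\<^sub>i\<close>, \<open>e\<^sub>i\<^sub>+\<^sub>3 e\<^sub>i = e\<^sub>i\<^sub>+\<^sub>1\<close> cover the cases
  \<open>j - i = 1, 2, 4\<close>; the cases \<open>i - j = 1, 2, 4\<close> follow by anticommutativity.
\<close>

abbreviation oct_e :: "7 option \<Rightarrow> real ^ 7 option" where
  "oct_e k \<equiv> axis k 1"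

fun oct_table :: "7 option \<Rightarrow> 7 option \<Rightarrow> real ^ 7 option" where
  "oct_table None k = oct_e k"
| "oct_table k None = oct_e k"
| "oct_table (Some i) (Some j) =
     (if j = i then - oct_e None
      else if j = i + 1 then oct_e (Some (i + 3))
      else if j = i + 2 then oct_e (Some (i - 1))
      else if j = i + 4 then oct_e (Some (j + 1))
      else if i = j + 1 then - oct_e (Some (j + 3))
      else if i = j + 2 then - oct_e (Some (j - 1))
      else - oct_e (Some (i + 1)))"

definition octonion_mult :: "real ^ 7 option \<Rightarrow> real ^ 7 option \<Rightarrow> real ^ 7 option" where
  "octonion_mult = bilinear_extension oct_table"

lemma octonion_mult_axis: "octonion_mult (oct_e k) (oct_e l) = oct_table k l"
  by (simp add: octonion_mult_def bilinear_extension_axis)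

lemma octonion_mult_one:
  "octonion_mult (oct_e None) a = a" "octonion_mult a (oct_e None) = a"
proof -
  have None_right: "oct_table k None = oct_e k" for k
    by (cases k) simp_all
  have ext: "f = g" if "linear f" "linear g" "\<And>k. f (oct_e k) = g (oct_e k)"
    for f g :: "real ^ 7 option \<Rightarrow> real ^ 7 option"
    using that by (intro linear_eq_stdbasis) (auto simp: Basis_vec_def)
  have bil: "bilinear octonion_mult"
    unfolding octonion_mult_def by (rule bilinear_bilinear_extension)
  have "octonion_mult (oct_e None) = (\<lambda>a. a)"
    using bil by (intro ext) (auto simp: bilinear_def linear_id[unfolded id_def] octonion_mult_axis)
  then show "octonion_mult (oct_e None) a = a"
    by simp
  have "(\<lambda>a. octonion_mult a (oct_e None)) = (\<lambda>a. a)"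
    using bil by (intro ext) (auto simp: bilinear_def linear_id[unfolded id_def] octonion_mult_axis None_right)
  then show "octonion_mult a (oct_e None) = a"
    by meson
qed

lemma octonion_mult_relations:
  fixes i j :: 7
  shows "octonion_mult (oct_e (Some i)) (oct_e (Some i)) = - oct_e None"
    and "i \<noteq> j \<Longrightarrow> octonion_mult (oct_e (Some i)) (oct_e (Some j)) =
           - octonion_mult (oct_e (Some j)) (oct_e (Some i))"
    and "octonion_mult (oct_e (Some i)) (oct_e (Some (i + 1))) = oct_e (Some (i + 3))"
    and "octonion_mult (oct_e (Some (i + 1))) (oct_e (Some (i + 3))) = oct_e (Some i)"
    and "octonion_mult (oct_e (Some (i + 3))) (oct_e (Some i)) = oct_e (Some (i + 1))"
proof -
  show "octonion_mult (oct_e (Some i)) (oct_e (Some j)) =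
           - octonion_mult (oct_e (Some j)) (oct_e (Some i))" if "i \<noteq> j"
  proof -
    obtain d where d: "j = i + d"
      by (metis add_diff_cancel_left' diff_add_cancel add.commute)
    consider "d = 0" | "d = 1" | "d = 2" | "d = 3" | "d = 4" | "d = 5" | "d = 6"
    proof (cases d rule: bit1_cases)
      case (of_int z)
      then have "z \<in> {0, 1, 2, 3, 4, 5, 6}" by auto
      with of_int that show thesis by auto
    qed
    then show ?thesis
      using \<open>i \<noteq> j\<close> unfolding d
      by cases (simp_all add: octonion_mult_axis algebra_simps)
  qed
qed (simp_all add: octonion_mult_axis)

end

theory Submission
  imports Defs "HOL-Number_Theory.Cong"
begin

text \<open>
  Let \<open>F\<close> be the field with eight elements. For \<open>x \<noteq> 0\<close> the sign exponent is
  \<open>\<phi>(x, y) = tr (y / x)\<close>, so it depends only on the ratio of \<open>x\<close> and \<open>y\<close>.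

  \<^bold>\<open>Isomorphism.\<close> Choose a root \<open>a \<in> F\<close> of \<open>X\<^sup>3 = X + 1\<close>. It generates the multiplicative
  group, which has prime order \<open>7\<close>. Its conjugates are \<open>a, a\<^sup>2, a\<^sup>4\<close>; they are the
  roots of \<open>X\<^sup>3 + X + 1\<close>, so their trace is the vanishing coefficient of \<open>X\<^sup>2\<close>, while
  \<open>1, a\<^sup>3, a\<^sup>5, a\<^sup>6\<close> have trace \<open>1\<close>. Hence, for
  \<open>j - i \<in> {1, 2, 4}\<close>, the basis vectors with exponents \<open>a\<^sup>i\<close> and \<open>a\<^sup>j\<close> multiply with
  sign \<open>+\<close>, and for the other differences with sign \<open>-\<close>. The equation \<open>1 + a = a\<^sup>3\<close> turns
  addition of exponents into the rule \<open>e\<^sub>i e\<^sub>i\<^sub>+\<^sub>1 = e\<^sub>i\<^sub>+\<^sub>3\<close>. So the relabelling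
  \<open>\<infinity> \<mapsto> 0\<close>, \<open>i \<mapsto> a\<^sup>i\<close> of basis vectors (\<open>octonion_index\<close>) carries one
  multiplication table to the other without any change of sign (\<open>oct_table_eq_twisted\<close>).

  \<^bold>\<open>Division.\<close> Since \<open>\<phi>\<close> is additive in its second argument, the operators
  \<open>L\<^sub>x\<close> of left multiplication by \<open>e\<^sup>x\<close> satisfy \<open>L\<^sub>x L\<^sub>y = \<plusminus> L\<^sub>y L\<^sub>x\<close> with the sign
  \<open>(-1)\<close> to the power \<open>\<phi>(x, y) + \<phi>(y, x)\<close>. For distinct nonzero \<open>x\<close> and \<open>y\<close> this
  exponent is \<open>tr (t) + tr (1/t)\<close> with \<open>t = y / x \<noteq> 1\<close>, which is the sum of
  \<open>t, t\<^sup>2, \<dots>, t\<^sup>6\<close> and therefore equals \<open>1\<close> (\<open>F8_phi_swap\<close>). So the \<open>L\<^sub>x\<close> with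
  \<open>x \<noteq> 0\<close> anticommute and square to \<open>-1\<close>: they are Clifford generators. It follows that
  left multiplication by \<open>a\<close> is inverted by that of the conjugate of \<open>a\<close>, up to the factor
  \<open>a \<bullet> a\<close> (\<open>twisted_conj_mult\<close>). There are thus no zero divisors, which suffices in
  finite dimension.

  \<^bold>\<open>Non-associativity.\<close> The basis vectors with exponents \<open>1, a, a\<^sup>6\<close> do not associate.
\<close>

section \<open>The field with eight elements\<close>

text \<open>Multiplication by \<open>x\<close> permutes the nonzero elements, so it does not change their product.\<close>

lemma power_card_minus_one_eq_one:
  fixes x :: "'f::{field, finite}"
  assumes "x \<noteq> 0"
  shows "x ^ (CARD('f) - 1) = 1"
proof -
  have "(\<Prod>y\<in>UNIV - {0}. x * y) = (\<Prod>y\<in>UNIV - {0}. y)"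
    by (rule prod.reindex_bij_witness[of _ "\<lambda>y. y / x" "\<lambda>y. x * y"]) (use assms in auto)
  then have "x ^ (CARD('f) - 1) * \<Prod>(UNIV - {0 :: 'f}) = \<Prod>(UNIV - {0})"
    by (simp add: prod.distrib card_Diff_singleton)
  then show ?thesis
    by simp
qed

lemma F8_power7:
  fixes x :: "'f::{field, finite}"
  assumes "CARD('f) = 8" "x \<noteq> 0"
  shows "x ^ 7 = 1"
  using power_card_minus_one_eq_one[OF assms(2)] assms(1) by simp

lemma F8_two_eq_zero:
  assumes "CARD('f::{field, finite}) = 8"
  shows "(2 :: 'f) = 0"
proof -
  have "(-1 :: 'f) ^ 7 = 1"
    by (rule F8_power7[OF assms]) simp
  then show ?thesis
    by (simp add: neg_eq_iff_add_eq_0 eq_neg_iff_add_eq_0)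
qed

text \<open>
  Polynomial identities that hold only in characteristic \<open>2\<close> are proved below by exhibiting
  their defect \<open>2 * k\<close> explicitly: the corrected identity follows from the other
  hypotheses over the integers, where the Groebner basis method applies.
\<close>

lemma eq_if_two_eq_zero:
  fixes x y k :: "'a::comm_ring_1"
  assumes "(2 :: 'a) = 0" "x = y + 2 * k"
  shows "x = y"
  using assms by simp

text \<open>
  Modulo \<open>2\<close>, \<open>X\<^sup>7 - 1\<close> is \<open>(X - 1) (X\<^sup>3 + X + 1) (X\<^sup>3 + X\<^sup>2 + 1)\<close>. Any element
  \<open>b\<close> other than \<open>0\<close> and \<open>1\<close> is a root of one of the cubics, and inversion
  \<open>b \<mapsto> b\<^sup>6\<close> exchanges the roots of the two.
\<close>

lemma F8_primitive_element:
  assumes "CARD('f::{field, finite}) = 8"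
  obtains a :: "'f::{field, finite}" where "a ^ 3 = a + 1"
proof -
  have two: "(2 :: 'f) = 0"
    by (rule F8_two_eq_zero[OF assms])
  have "\<not> UNIV \<subseteq> {0, 1 :: 'f}"
    using card_mono[of "{0, 1 :: 'f}" UNIV] assms by auto
  then obtain b :: 'f where b: "b \<noteq> 0" "b \<noteq> 1"
    by auto
  have b7: "b ^ 7 = 1"
    by (rule F8_power7[OF assms b(1)])
  have "(b - 1) * ((b ^ 3 + b + 1) * (b ^ 3 + b ^ 2 + 1)) = 0"
    by (rule eq_if_two_eq_zero[OF two, where k = "b ^ 3 * (b - 1)"]) (use b7 in algebra)
  then consider "b ^ 3 + b + 1 = 0" | "b ^ 3 + b ^ 2 + 1 = 0"
    using b by auto
  then show ?thesis
  proof cases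
    case 1
    have "b ^ 3 = b + 1"
      by (rule eq_if_two_eq_zero[OF two, where k = "- (b + 1)"]) (use 1 in algebra)
    then show ?thesis
      by (rule that)
  next
    case 2
    have "(b ^ 6) ^ 3 = (b ^ 7) ^ 2 * b ^ 4"
      by algebra
    also have "\<dots> = b ^ 4"
      using b7 by simp
    also have "b ^ 4 = b ^ 6 + 1"
      by (rule eq_if_two_eq_zero[OF two, where k = "- (b ^ 2 + 1)"]) (use 2 in algebra)
    finally have "(b ^ 6) ^ 3 = b ^ 6 + 1" .
    then show ?thesis
      by (rule that)
  qed
qed

lemma F8_tr_add:
  fixes x y :: "'f::{field, finite}"
  assumes "CARD('f) = 8"
  shows "tr (x + y) = tr x + tr y"
  unfolding tr_def
  by (rule eq_if_two_eq_zero[OF F8_two_eq_zero[OF assms],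
        where k = "x * y + 2 * x ^ 3 * y + 3 * x ^ 2 * y ^ 2 + 2 * x * y ^ 3"]) algebra

lemma F8_primitive_power7:
  fixes a :: "'f::{field, finite}"
  assumes "CARD('f) = 8" "a ^ 3 = a + 1"
  shows "a ^ 7 = 1"
  using assms by (intro F8_power7) auto

text \<open>
  The three conjugates \<open>a, a\<^sup>2, a\<^sup>4\<close> share one trace, and so do the conjugates
  \<open>a\<^sup>3, a\<^sup>5, a\<^sup>6\<close>.
\<close>

lemma F8_tr_values:
  fixes a :: "'f::{field, finite}"
  assumes card: "CARD('f) = 8" and a: "a ^ 3 = a + 1"
  shows "tr (1 :: 'f) = 1" "tr a = 0" "tr (a ^ 2) = 0" "tr (a ^ 3) = 1" "tr (a ^ 4) = 0"
    "tr (a ^ 5) = 1" "tr (a ^ 6) = 1"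
proof -
  have two: "(2 :: 'f) = 0"
    by (rule F8_two_eq_zero[OF card])
  have a7: "a ^ 7 = 1"
    by (rule F8_primitive_power7[OF assms])
  show "tr (1 :: 'f) = 1"
    unfolding tr_def by (rule eq_if_two_eq_zero[OF two, where k = 1]) simp
  have reduce: "a ^ 8 = a" "a ^ 10 = a ^ 3" "a ^ 12 = a ^ 5" "a ^ 16 = a ^ 2" "a ^ 20 = a ^ 6"
    "a ^ 24 = a ^ 3"
    using a7 by algebra+
  have "a + a ^ 2 + a ^ 4 = 0"
    by (rule eq_if_two_eq_zero[OF two, where k = "a ^ 2 + a"]) (use a in algebra)
  then show "tr a = 0" "tr (a ^ 2) = 0" "tr (a ^ 4) = 0"
    by (simp_all add: tr_def reduce add_ac)
  have "a ^ 3 + a ^ 5 + a ^ 6 = 1"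
    by (rule eq_if_two_eq_zero[OF two, where k = "(a + 1) ^ 2"]) (use a in algebra)
  then show "tr (a ^ 3) = 1" "tr (a ^ 5) = 1" "tr (a ^ 6) = 1"
    by (simp_all add: tr_def reduce add_ac)
qed

lemma F8_phi_add:
  fixes x y z :: "'f::{field, finite}"
  assumes "CARD('f) = 8"
  shows "phi x (y + z) = phi x y + phi x z"
  by (simp add: phi_def distrib_right F8_tr_add[OF assms])

lemma F8_phi_same:
  fixes x :: "'f::{field, finite}"
  assumes "CARD('f) = 8" "x \<noteq> 0"
  shows "phi x x = 1"
proof -
  have "x * x ^ 6 = 1"
    using F8_power7[OF assms] by algebra
  then show ?thesis
    using F8_two_eq_zero[OF assms(1)] by (simp add: phi_def tr_def)
qed

text \<open>
  With \<open>t = y / x\<close>, the exponents that occur in \<open>tr t\<close> and \<open>tr (t\<^sup>6)\<close> are together all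
  the nonzero residues modulo \<open>7\<close>, and the seven powers of \<open>t \<noteq> 1\<close> sum to zero.
  This is what makes the imaginary basis vectors anticommute.
\<close>

lemma F8_phi_swap:
  fixes x y :: "'f::{field, finite}"
  assumes card: "CARD('f) = 8" and "x \<noteq> 0" "y \<noteq> 0" "x \<noteq> y"
  shows "phi x y + phi y x = 1"
proof -
  have two: "(2 :: 'f) = 0"
    by (rule F8_two_eq_zero[OF card])
  define t where "t = y * x ^ 6"
  have x7: "x ^ 7 = 1" and y7: "y ^ 7 = 1"
    using F8_power7[OF card] assms by auto
  have t7: "t ^ 7 = 1"
    unfolding t_def using x7 y7 by algebra
  have xt: "x * t = y"
    unfolding t_def using x7 by algebra
  have "t \<noteq> 1"
    using xt \<open>x \<noteq> y\<close> by auto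
  moreover have "(t - 1) * (1 + t + t ^ 2 + t ^ 3 + t ^ 4 + t ^ 5 + t ^ 6) = 0"
    using t7 by algebra
  ultimately have sum: "1 + t + t ^ 2 + t ^ 3 + t ^ 4 + t ^ 5 + t ^ 6 = 0"
    by simp
  have "x * y ^ 6 = t ^ 6"
    unfolding xt[symmetric] using x7 by algebra
  then have "phi x y + phi y x = tr t + tr (t ^ 6)"
    by (simp add: phi_def t_def)
  also have "\<dots> = 1"
    unfolding tr_def by (rule eq_if_two_eq_zero[OF two, where k = "-1"]) (use sum t7 in algebra)
  finally show ?thesis .
qed

lemma F8_phi_in_prime_field:
  fixes x y :: "'f::{field, finite}"
  assumes "CARD('f) = 8"
  shows "phi x y \<in> {0, 1}"
  unfolding phi_def by (rule tr_in_prime_field[OF assms])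

lemma sign_pow_add:
  fixes d e :: "'f::{field, finite}"
  assumes "CARD('f) = 8" "d \<in> {0, 1}" "e \<in> {0, 1}"
  shows "sign_pow (d + e) = sign_pow d * sign_pow e"
  using assms(2,3) F8_two_eq_zero[OF assms(1)] by (auto simp: sign_pow_def)

lemma phi_zero [simp]: "phi 0 y = 0" "phi x 0 = 0"
  by (simp_all add: phi_def tr_def)

lemma sign_pow_zero_one [simp]: "sign_pow 0 = 1" "sign_pow 1 = -1"
  by (simp_all add: sign_pow_def)

section \<open>The twisted group algebra has no zero divisors\<close>

lemma bilinear_twisted_mult: "bilinear twisted_mult"
  unfolding twisted_mult_def by (rule bilinear_bilinear_extension)

lemmas twisted_mult_linear_simps =
  bilinear_ladd[OF bilinear_twisted_mult] bilinear_radd[OF bilinear_twisted_mult]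
  bilinear_lmul[OF bilinear_twisted_mult] bilinear_rmul[OF bilinear_twisted_mult]
  bilinear_lneg[OF bilinear_twisted_mult] bilinear_rneg[OF bilinear_twisted_mult]

text \<open>
  The product of the last two signs is symmetric in \<open>x\<close> and \<open>y\<close>, so
  only the first sign decides whether two left multiplications commute or anticommute.
\<close>

lemma twisted_mult_axis3:
  fixes x y z :: "'f::{field, finite}"
  assumes "CARD('f) = 8"
  shows "twisted_mult (axis x 1) (twisted_mult (axis y 1) (axis z 1)) =
    (sign_pow (phi x y) * sign_pow (phi x z) * sign_pow (phi y z)) *\<^sub>R axis (x + y + z) 1"
  by (simp add: twisted_mult_axis twisted_mult_linear_simps F8_phi_add[OF assms] add_ac mult_ac
      sign_pow_add[OF assms F8_phi_in_prime_field[OF assms] F8_phi_in_prime_field[OF assms]])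

definition twisted_conj :: "(real, 'f::{field, finite}) vec \<Rightarrow> (real, 'f) vec" where
  "twisted_conj a = (\<chi> x. if x = 0 then a $ x else - a $ x)"

lemma twisted_conj_linear_simps:
  "twisted_conj (a + b) = twisted_conj a + twisted_conj b"
  "twisted_conj (c *\<^sub>R a) = c *\<^sub>R twisted_conj a"
  by (simp_all add: twisted_conj_def vec_eq_iff)

lemma twisted_conj_axis: "twisted_conj (axis x 1) = (if x = 0 then axis x 1 else - axis x 1)"
  by (auto simp: twisted_conj_def vec_eq_iff axis_def)

text \<open>
  The identity \<open>a\<^sup>* (a b) = (a \<bullet> a) b\<close> is quadratic in \<open>a\<close>. Its polarization is
  linear in each of \<open>a, a', b\<close>, so it needs to be checked only on basis vectors, where it is
  the Clifford relation between two left multiplications.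
\<close>

lemma twisted_conj_mult_polarized:
  fixes a a' b :: "(real, 'f::{field, finite}) vec"
  assumes card: "CARD('f) = 8"
  shows "twisted_mult (twisted_conj a) (twisted_mult a' b) +
         twisted_mult (twisted_conj a') (twisted_mult a b) = (2 * (a \<bullet> a')) *\<^sub>R b"
proof -
  let ?F = "\<lambda>a a' b. twisted_mult (twisted_conj a) (twisted_mult a' b) +
         twisted_mult (twisted_conj a') (twisted_mult a b)"
  have basis: "?F (axis x 1) (axis y 1) (axis z 1) =
      (2 * (axis x (1::real) \<bullet> axis y 1)) *\<^sub>R (axis z 1 :: (real, 'f) vec)" for x y z :: 'f
  proof (cases "x = y")
    case True
    have "sign_pow (phi x z) * sign_pow (phi x z) = 1"
      by (simp add: sign_pow_def)
    moreover have "x + x = 0"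
      using F8_two_eq_zero[OF card] by (simp flip: mult_2)
    ultimately show ?thesis
      using True F8_phi_same[OF card]
      by (auto simp: twisted_conj_axis twisted_mult_linear_simps twisted_mult_axis3[OF card]
          inner_axis_axis inner_real_def mult.assoc simp flip: scaleR_2)
  next
    case False
    have "sign_pow (phi x y) = - sign_pow (phi y x)" if "x \<noteq> 0" "y \<noteq> 0"
      using F8_phi_swap[OF card that False] F8_phi_in_prime_field[OF card, of x y]
        F8_phi_in_prime_field[OF card, of y x] F8_two_eq_zero[OF card]
      by auto
    then show ?thesis
      using False by (auto simp: twisted_conj_axis twisted_mult_linear_simps
          twisted_mult_axis3[OF card] inner_axis_axis add_ac mult_ac)
  qed
  have linear_last: "?F (axis x 1) (axis y 1) = (\<lambda>b. (2 * (axis x (1::real) \<bullet> axis y 1)) *\<^sub>R b)"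
    for x y :: 'f
    by (rule linear_eq_stdbasis)
      (auto simp: linear_iff twisted_mult_linear_simps Basis_vec_def basis algebra_simps)
  have "(\<lambda>a a'. ?F a a' b) = (\<lambda>a a'. (2 * (a \<bullet> a')) *\<^sub>R b)"
    by (rule bilinear_eq_stdbasis)
      (auto simp: bilinear_def linear_iff twisted_mult_linear_simps twisted_conj_linear_simps
        Basis_vec_def fun_cong[OF linear_last] algebra_simps inner_add_left inner_add_right)
  then show ?thesis
    by meson
qed

lemma twisted_conj_mult:
  fixes a b :: "(real, 'f::{field, finite}) vec"
  assumes "CARD('f) = 8"
  shows "twisted_mult (twisted_conj a) (twisted_mult a b) = (a \<bullet> a) *\<^sub>R b"
  using twisted_conj_mult_polarized[OF assms, of a a b]
  by (simp flip: scaleR_2 scaleR_scaleR)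

text \<open>In finite dimension an injective left or right multiplication is bijective.\<close>

lemma division_algebra_if_no_zero_divisors:
  fixes m :: "'a::euclidean_space \<Rightarrow> 'a \<Rightarrow> 'a"
  assumes "bilinear m" and "\<And>a b. m a b = 0 \<Longrightarrow> a = 0 \<or> b = 0"
  shows "division_algebra m"
proof -
  have bij: "bij f" if "linear f" "\<And>x. f x = 0 \<Longrightarrow> x = 0" for f :: "'a \<Rightarrow> 'a"
    using that linear_injective_0[of f] linear_injective_imp_surjective[of f] by (auto simp: bij_def)
  have "\<exists>!x. m a x = b" "\<exists>!y. m y a = b" if "a \<noteq> 0" for a b
  proof -
    have "bij (m a)" "bij (\<lambda>y. m y a)"
      using assms that by (auto intro!: bij simp: bilinear_def)
    then show "\<exists>!x. m a x = b" "\<exists>!y. m y a = b"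
      by (auto simp: bij_iff)
  qed
  moreover have "\<exists>a::'a. a \<noteq> 0"
    using nonzero_Basis SOME_Basis by blast
  ultimately show ?thesis
    using assms(1) by (auto simp: division_algebra_def)
qed

lemma division_algebra_twisted_mult:
  assumes "CARD('f::{field, finite}) = 8"
  shows "division_algebra (twisted_mult :: (real, 'f) vec \<Rightarrow> _)"
proof (rule division_algebra_if_no_zero_divisors[OF bilinear_twisted_mult])
  fix a b :: "(real, 'f) vec"
  assume "twisted_mult a b = 0"
  then have "(a \<bullet> a) *\<^sub>R b = 0"
    using twisted_conj_mult[OF assms, of a b] bilinear_rzero[OF bilinear_twisted_mult] by metis
  then show "a = 0 \<or> b = 0"
    by simp
qed

section \<open>The twisted group algebra is not associative\<close>

lemma not_associative_twisted_mult:
  assumes card: "CARD('f::{field, finite}) = 8"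
  shows "\<not> associative_product (twisted_mult :: (real, 'f) vec \<Rightarrow> _)"
proof
  assume assoc: "associative_product (twisted_mult :: (real, 'f) vec \<Rightarrow> _)"
  obtain a :: 'f where a: "a ^ 3 = a + 1"
    by (rule F8_primitive_element[OF card])
  have a7: "a ^ 7 = 1"
    by (rule F8_primitive_power7[OF card a])
  \<comment> \<open>\<open>phi\<close> fails to be additive in its first argument at \<open>1\<close> and \<open>a\<close>;
    \<open>a\<^sup>6 = 1 / a\<close> as the second argument detects this.\<close>
  have "twisted_mult (twisted_mult (axis 1 1) (axis a 1)) (axis (a ^ 6) 1) =
      twisted_mult (axis 1 1) (twisted_mult (axis a 1) (axis (a ^ 6) (1::real)))"
    using assoc by (simp add: associative_product_def)
  moreover have "a ^ 6 * (1 + a) ^ 6 = a ^ 3" "a ^ 6 * a ^ 6 = a ^ 5"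
    using a a7 by algebra+
  then have "phi 1 a = 0" "phi (1 + a) (a ^ 6) = 1" "phi 1 (a ^ 6) = 1" "phi a (a ^ 6) = 1"
    by (simp_all add: phi_def F8_tr_values[OF card a])
  ultimately have "- axis (1 + a + a ^ 6) (1::real) = (axis (1 + a + a ^ 6) 1 :: (real, 'f) vec)"
    by (simp add: twisted_mult_axis3[OF card])
       (simp add: twisted_mult_axis twisted_mult_linear_simps)
  from arg_cong[OF this, of "\<lambda>v. v $ (1 + a + a ^ 6)"] show False
    by (simp add: axis_def)
qed

section \<open>The isomorphism with the octonions\<close>

text \<open>
  This is \<open>a\<^sup>i\<close> for an exponent \<open>i\<close> modulo \<open>7\<close>. The least representative is only one
  choice: \<open>power7_of_nat\<close> shows that any other gives the same power when \<open>a\<^sup>7 = 1\<close>.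
\<close>

definition power7 :: "'f::field \<Rightarrow> 7 \<Rightarrow> 'f" where
  "power7 a i = a ^ (LEAST n. of_nat n = i)"

lemma Z7_cases:
  obtains "(i::7) = 0" | "i = 1" | "i = 2" | "i = 3" | "i = 4" | "i = 5" | "i = 6"
proof (cases i rule: bit1_cases)
  case (of_int z)
  then have "z \<in> {0, 1, 2, 3, 4, 5, 6}"
    by auto
  with of_int that show thesis
    by auto
qed

lemma power7_of_nat:
  assumes "a ^ 7 = 1"
  shows "power7 a (of_nat n) = a ^ n"
proof -
  define k where "k = (LEAST k. of_nat k = (of_nat n :: 7))"
  have "of_nat k = (of_nat n :: 7)"
    unfolding k_def by (rule LeastI) simp
  then have "k mod 7 = n mod 7"
    by (simp add: of_nat_eq_iff_cong_CHAR cong_def)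
  moreover have "a ^ m = a ^ (m mod 7)" for m
    using assms by (metis mult_div_mod_eq power_add power_mult power_one mult_1)
  ultimately show ?thesis
    unfolding power7_def k_def by metis
qed

lemma power7_add:
  assumes "a ^ 7 = 1"
  shows "power7 a (i + j) = power7 a i * power7 a j"
proof -
  have "\<exists>n. i = of_nat n" for i :: 7
    by (cases i rule: bit1_cases) (metis of_int_of_nat_eq zero_le_imp_eq_int)
  then obtain m n where "i = of_nat m" "j = of_nat n"
    by meson
  then show ?thesis
    using power7_of_nat[OF assms, of m] power7_of_nat[OF assms, of n]
      power7_of_nat[OF assms, of "m + n"] by (simp add: power_add)
qed

fun octonion_index :: "'f::field \<Rightarrow> 7 option \<Rightarrow> 'f" where
  "octonion_index a None = 0"
| "octonion_index a (Some i) = power7 a i"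

lemma power7_values:
  assumes "a ^ 7 = 1"
  shows "power7 a 0 = 1" "power7 a 1 = a" "power7 a 2 = a ^ 2" "power7 a 3 = a ^ 3"
    "power7 a 4 = a ^ 4" "power7 a 5 = a ^ 5" "power7 a 6 = a ^ 6"
  using power7_of_nat[OF assms, of 0] power7_of_nat[OF assms, of 1] power7_of_nat[OF assms, of 2]
    power7_of_nat[OF assms, of 3] power7_of_nat[OF assms, of 4] power7_of_nat[OF assms, of 5]
    power7_of_nat[OF assms, of 6]
  by simp_all

text \<open>
  The powers of \<open>a\<close> are distinct because \<open>i \<mapsto> a\<^sup>i\<close> is a homomorphism with trivial kernel;
  with \<open>0\<close> they are eight elements, hence the whole field.
\<close>

lemma bij_octonion_index:
  fixes a :: "'f::{field, finite}"
  assumes card: "CARD('f) = 8" and a: "a ^ 3 = a + 1"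
  shows "bij (octonion_index a)"
proof -
  have a7: "a ^ 7 = 1"
    by (rule F8_primitive_power7[OF card a])
  then have "a \<noteq> 0"
    by auto
  have nonzero: "power7 a i \<noteq> 0" for i
    using \<open>a \<noteq> 0\<close> by (simp add: power7_def)
  have trivial_kernel: "d = 0" if "power7 a d = 1" for d
  proof (rule ccontr)
    assume "d \<noteq> 0"
    \<comment> \<open>These powers have trace \<open>0\<close>, whereas \<open>1\<close> has trace \<open>1\<close>.\<close>
    have "a \<noteq> 1" "a ^ 2 \<noteq> 1" "a ^ 4 \<noteq> 1"
      using F8_tr_values[OF card a] by force+
    moreover have "a ^ 5 * a ^ 2 = 1" "a ^ 6 * a = 1"
      using a7 by algebra+
    with calculation have "a ^ 5 \<noteq> 1" "a ^ 6 \<noteq> 1"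
      by (metis mult_1)+
    moreover have "a ^ 3 \<noteq> 1"
      using a \<open>a \<noteq> 0\<close> by simp
    ultimately show False
      using that \<open>d \<noteq> 0\<close> by (cases d rule: Z7_cases) (simp_all add: power7_values[OF a7])
  qed
  have "i = j" if "power7 a i = power7 a j" for i j
  proof -
    have "power7 a (i - j) * power7 a j = 1 * power7 a j"
      using that power7_add[OF a7, of "i - j" j] by simp
    then show ?thesis
      using nonzero[of j] trivial_kernel[of "i - j"] by simp
  qed
  then have inj: "inj (octonion_index a)"
    using nonzero by (intro injI) (auto elim!: octonion_index.elims simp: nonzero[symmetric])
  moreover have "CARD(7 option) = CARD('f)"
    using card by (simp add: card_UNIV_option)
  ultimately have "surj (octonion_index a)"
    by (metis card_image card_subset_eq finite_class.finite_UNIV subset_UNIV)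
  with inj show ?thesis
    by (simp add: bij_def)
qed

text \<open>
  Imaginary units with indices \<open>i\<close> and \<open>i + d\<close> correspond to basis vectors whose product
  has sign exponent \<open>tr (a\<^sup>d)\<close> and basis index \<open>a\<^sup>i (1 + a\<^sup>d)\<close>. Both multiplication
  tables thus depend on \<open>i\<close> only through a shift, which leaves the seven values of \<open>d\<close>.
\<close>

lemma oct_table_eq_twisted:
  fixes a :: "'f::{field, finite}"
  assumes card: "CARD('f) = 8" and a: "a ^ 3 = a + 1"
  shows "\<exists>m. octonion_index a m = octonion_index a k + octonion_index a l \<and>
    oct_table k l = sign_pow (phi (octonion_index a k) (octonion_index a l)) *\<^sub>R oct_e m"
proof (cases "k = None \<or> l = None")
  case True
  then show ?thesis
  proof
    assume "k = None"
    then show ?thesis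
      by (intro exI[of _ l]) simp
  next
    assume "l = None"
    then show ?thesis
      by (intro exI[of _ k]) (cases k, simp_all)
  qed
next
  case False
  then obtain i j where kl: "k = Some i" "l = Some j"
    by auto
  define d where "d = j - i"
  have j: "j = i + d"
    by (simp add: d_def)
  have two: "(2 :: 'f) = 0"
    by (rule F8_two_eq_zero[OF card])
  have a7: "a ^ 7 = 1"
    by (rule F8_primitive_power7[OF card a])
  define p where "p = power7 a i"
  have "a \<noteq> 0"
    using a7 by auto
  then have "p ^ 7 = 1"
    unfolding p_def power7_def by (intro F8_power7[OF card]) simp
  then have phi: "phi p (p * t) = tr t" for t
    unfolding phi_def tr_def by algebra
  have double: "p + p = 0"
    using two by (simp flip: mult_2)
  \<comment> \<open>Adding \<open>1\<close> exchanges \<open>a\<close> with \<open>a\<^sup>3\<close>, \<open>a\<^sup>2\<close> with \<open>a\<^sup>6\<close>, and \<open>a\<^sup>4\<close> with \<open>a\<^sup>5\<close>;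
    this pairing also gives the index of the product of two imaginary octonion units.\<close>
  have sums:
    "p + p * a = p * a ^ 3" "p + p * a ^ 2 = p * a ^ 6" "p + p * a ^ 3 = p * a"
    "p + p * a ^ 4 = p * a ^ 5" "p + p * a ^ 5 = p * a ^ 4" "p + p * a ^ 6 = p * a ^ 2"
  proof -
    show "p + p * a = p * a ^ 3" "p + p * a ^ 4 = p * a ^ 5"
      using a by algebra+
    show "p + p * a ^ 2 = p * a ^ 6"
      by (rule eq_if_two_eq_zero[OF two, where k = "- (p * a)"]) (use a in algebra)
    show "p + p * a ^ 3 = p * a" "p + p * a ^ 5 = p * a ^ 4"
      by (rule eq_if_two_eq_zero[OF two, where k = p], use a in algebra)+
    show "p + p * a ^ 6 = p * a ^ 2"
      by (rule eq_if_two_eq_zero[OF two, where k = "p * (a + 1)"]) (use a in algebra)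
  qed
  note evaluations = power7_values[OF a7] F8_tr_values[OF card a] double sums
  have index: "octonion_index a (Some (i + s)) = p * power7 a s" for s
    by (simp add: p_def power7_add[OF a7])
  have "octonion_index a k = p" "octonion_index a l = p * power7 a d"
    by (simp_all add: kl p_def j power7_add[OF a7])
  moreover have "\<exists>m. octonion_index a m = p + p * power7 a d \<and>
    oct_table (Some i) (Some (i + d)) = sign_pow (tr (power7 a d)) *\<^sub>R oct_e m"
  proof (cases d rule: Z7_cases)
    case 1
    then show ?thesis
      by (intro exI[of _ None]) (simp add: evaluations)
  next
    case 2
    then show ?thesis
      by (intro exI[of _ "Some (i + 3)"])
        (simp add: evaluations index del: octonion_index.simps)
  next
    case 3
    have "i - 1 = i + 6"
      by (simp add: diff_eq_eq)
    with 3 show ?thesis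
      by (intro exI[of _ "Some (i + 6)"])
        (simp add: \<open>i - 1 = i + 6\<close> evaluations index del: octonion_index.simps)
  next
    case 4
    then show ?thesis
      by (intro exI[of _ "Some (i + 1)"])
        (simp add: evaluations index del: octonion_index.simps)
  next
    case 5
    then show ?thesis
      by (intro exI[of _ "Some (i + 5)"])
        (simp add: add.commute[of 5] evaluations index del: octonion_index.simps)
  next
    case 6
    then show ?thesis
      by (intro exI[of _ "Some (i + 4)"])
        (simp add: add.commute[of 4] evaluations index del: octonion_index.simps)
  next
    case 7
    \<comment> \<open>The octonion table names the index of the product \<open>j + 3\<close>, which is \<open>i + 9\<close>.\<close>
    have "(9 :: 7) = 2"
      by simp
    with 7 show ?thesis
      by (intro exI[of _ "Some (i + 2)"])
        (simp add: \<open>(9 :: 7) = 2\<close> add.commute[of 2] evaluations index del: octonion_index.simps)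
  qed
  ultimately show ?thesis
    by (simp add: kl j phi)
qed

text \<open>
  A bijection \<open>g\<close> between the index sets induces the isomorphism \<open>v \<mapsto> v \<circ> g\<close>, which sends
  the basis vector at \<open>g k\<close> to the one at \<open>k\<close>.
\<close>

lemma algebra_isomorphic_bilinear_extension:
  fixes g :: "'i::finite \<Rightarrow> 'j::finite"
    and p :: "'j \<Rightarrow> 'j \<Rightarrow> real ^ 'j" and q :: "'i \<Rightarrow> 'i \<Rightarrow> real ^ 'i"
  assumes "bij g" and table: "\<And>k l. (\<chi> m. p (g k) (g l) $ g m) = q k l"
  shows "algebra_isomorphic (bilinear_extension p) (bilinear_extension q)"
proof -
  define f :: "real ^ 'j \<Rightarrow> real ^ 'i" where "f v = (\<chi> k. v $ g k)" for v
  note bilinear_simps =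
    bilinear_ladd[OF bilinear_bilinear_extension] bilinear_radd[OF bilinear_bilinear_extension]
    bilinear_lmul[OF bilinear_bilinear_extension] bilinear_rmul[OF bilinear_bilinear_extension]
  have f_simps: "f (v + w) = f v + f w" "f (c *\<^sub>R v) = c *\<^sub>R f v" for v w c
    by (simp_all add: f_def vec_eq_iff)
  have f_axis: "f (axis (g k) 1) = axis k 1" for k
    using \<open>bij g\<close> by (auto simp: f_def vec_eq_iff axis_def bij_def inj_eq)
  have inv_g: "g (inv g x) = x" "inv g (g k) = k" for x k
    using \<open>bij g\<close> by (simp_all add: bij_def surj_f_inv_f)
  have "bij f"
    by (rule bij_betw_byWitness[where f' = "\<lambda>w. \<chi> x. w $ inv g x"])
      (auto simp: f_def vec_eq_iff inv_g)
  moreover have "(\<lambda>a b. f (bilinear_extension p a b)) = (\<lambda>a b. bilinear_extension q (f a) (f b))"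
  proof (rule bilinear_eq_stdbasis)
    fix v w :: "real ^ 'j"
    assume "v \<in> Basis" "w \<in> Basis"
    then obtain x y where "v = axis x 1" "w = axis y 1"
      by (auto simp: Basis_vec_def)
    then obtain k l where "v = axis (g k) 1" "w = axis (g l) 1"
      using inv_g by metis
    then show "f (bilinear_extension p v w) = bilinear_extension q (f v) (f w)"
      by (simp add: f_axis bilinear_extension_axis) (simp add: f_def table)
  qed (auto simp: bilinear_def linear_iff bilinear_simps f_simps)
  then have "f (bilinear_extension p a b) = bilinear_extension q (f a) (f b)" for a b
    by meson
  ultimately show ?thesis
    unfolding algebra_isomorphic_def by (intro exI[of _ f]) (auto simp: linear_iff f_simps)
qed

lemma algebra_isomorphic_twisted_octonion:
  assumes card: "CARD('f::{field, finite}) = 8"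
  shows "algebra_isomorphic (twisted_mult :: (real, 'f) vec \<Rightarrow> _) octonion_mult"
proof -
  obtain a :: 'f where a: "a ^ 3 = a + 1"
    by (rule F8_primitive_element[OF card])
  have bij: "bij (octonion_index a)"
    by (rule bij_octonion_index[OF card a])
  show ?thesis
    unfolding twisted_mult_def octonion_mult_def
  proof (rule algebra_isomorphic_bilinear_extension[OF bij])
    fix k l
    obtain m where m: "octonion_index a m = octonion_index a k + octonion_index a l"
      and table: "oct_table k l = sign_pow (phi (octonion_index a k) (octonion_index a l)) *\<^sub>R oct_e m"
      using oct_table_eq_twisted[OF card a] by metis
    show "(\<chi> n. (sign_pow (phi (octonion_index a k) (octonion_index a l)) *\<^sub>R
        axis (octonion_index a k + octonion_index a l) 1) $ octonion_index a n) = oct_table k l"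
      unfolding table m[symmetric] using bij by (simp add: vec_eq_iff axis_def bij_def inj_eq)
  qed
qed

theorem theorem1:
  assumes "CARD('f::{field, finite}) = 8"
  shows "algebra_isomorphic (twisted_mult :: (real, 'f) vec \<Rightarrow> _) octonion_mult
    \<and> \<not> associative_product (twisted_mult :: (real, 'f) vec \<Rightarrow> _)
    \<and> division_algebra (twisted_mult :: (real, 'f) vec \<Rightarrow> _)"
  using algebra_isomorphic_twisted_octonion[OF assms] not_associative_twisted_mult[OF assms]
    division_algebra_twisted_mult[OF assms]
  by blast

end
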